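(* Let $$f(q)=\sum_{n=0}^\infty \frac{q^{n^2}}{(-q;q)_n^2}$$ be Ramanujan's third order mock theta function. Then, as formal power series in $q$, $$f(q)=\frac{(q;q)_\infty}{(q^2;q^2)_\infty^2}\sum_{n=0}^\infty\ \sum_{m=-\lfloor n/2\rfloor}^{\lfloor n/2\rfloor}\operatorname{sgn}(m)\,q^{\frac12(n^2-3m^2)+\frac12(n-m)},$$ or, equivalently, $$\left(\sum_{n=0}^\infty q^{\frac12n(n+1)}\right) f(q)=\sum_{n=0}^\infty\ \sum_{m=-\lfloor n/2\rfloor}^{\lfloor n/2\rfloor}\operatorname{sgn}(m)\,q^{\frac12(n^2-3m^2)+\frac12(n-m)}.$$
   Context: Notation: $(a;q)_\infty=\prod_{k\ge 0}(1-aq^k)$, $(a;q)_n=\prod_{k=0}^{n-1}(1-aq^k)$. Here $\operatorname{sgn}(m)=1$ if $m\ge 0$ (in particular $\operatorname{sgn}(0)=1$) and $\operatorname{sgn}(m)=-1$ if $m<0$. $\lfloor x\rfloor$ is the integer part of $x$. *)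

theory Defs
  imports "HOL-Analysis.Analysis"
begin

text \<open>
  Infinite sums and products of formal power series are the library's \<^const>\<open>suminf\<close> and
  \<^const>\<open>prodinf\<close> with respect to the topology of coefficientwise stabilisation.
  Since these are arbitrary when there is no convergence, the lemmas at the end show that
  every infinite sum and product that is used does converge.
\<close>

definition qpoch :: "'a::comm_ring_1 \<Rightarrow> 'a \<Rightarrow> nat \<Rightarrow> 'a" where
  "qpoch a q n = (\<Prod>k<n. 1 - a * q ^ k)"

definition qpoch_inf :: "'a::{t2_space, comm_ring_1} \<Rightarrow> 'a \<Rightarrow> 'a" where
  "qpoch_inf a q = (\<Prod>k. 1 - a * q ^ k)"

text \<open>In contrast to \<^const>\<open>sgn\<close>, the value at 0 is 1.\<close>

definition sgn1 :: "int \<Rightarrow> int" where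
  "sgn1 m = (if m \<ge> 0 then 1 else -1)"

definition mock_theta_f :: "'a::field_char_0 fps" where
  "mock_theta_f = (\<Sum>n. fps_X ^ (n\<^sup>2) / (qpoch (- fps_X) fps_X n)\<^sup>2)"

text \<open>
  The exponent $\frac12(n^2-3m^2)+\frac12(n-m)$. Only the sum of the two halves is an integer
  in general, so they are put over a common denominator. For $2|m| \le n$ neither integer division
  nor \<^const>\<open>nat\<close> loses information.
\<close>

definition hecke_exp :: "nat \<Rightarrow> int \<Rightarrow> nat" where
  "hecke_exp n m = nat (((int n ^ 2 - 3 * m ^ 2) + (int n - m)) div 2)"

lemma hecke_exp_bound:
  assumes "m \<in> {- int (n div 2)..int (n div 2)}"
  shows   "(int n ^ 2 - 3 * m ^ 2) + (int n - m) \<ge> int n div 2"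
proof -
  have m: "2 * \<bar>m\<bar> \<le> int n" using assms by auto
  have "(2 * \<bar>m\<bar>)\<^sup>2 \<le> (int n)\<^sup>2" by (rule power_mono[OF m]) auto
  hence "4 * m\<^sup>2 \<le> (int n)\<^sup>2" by (simp add: power_mult_distrib)
  moreover have "0 \<le> m\<^sup>2" by simp
  ultimately show ?thesis using m by linarith
qed

lemma real_hecke_exp:
  assumes "m \<in> {- int (n div 2)..int (n div 2)}"
  shows   "real (hecke_exp n m) =
             (1/2) * (real n ^ 2 - 3 * real_of_int m ^ 2) + (1/2) * (real n - real_of_int m)"
proof -
  let ?e = "(int n ^ 2 - 3 * m ^ 2) + (int n - m)"
  have "even ?e" by simp
  hence "real_of_int (?e div 2) = real_of_int ?e / 2"
    by (simp add: real_of_int_div)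
  moreover have "?e div 2 \<ge> 0" using hecke_exp_bound[OF assms] by linarith
  ultimately show ?thesis by (simp add: hecke_exp_def algebra_simps add_divide_distrib diff_divide_distrib)
qed

lemma hecke_exp_ge:
  assumes "m \<in> {- int (n div 2)..int (n div 2)}"
  shows   "hecke_exp n m \<ge> n div 4"
  using hecke_exp_bound[OF assms] unfolding hecke_exp_def by linarith

lemma fps_summableI:
  fixes F :: "nat \<Rightarrow> 'a::comm_ring_1 fps"
  assumes "\<And>k n. n \<ge> N k \<Longrightarrow> fps_nth (F n) k = 0"
  shows   "summable F"
proof -
  have "(\<lambda>n. \<Sum>i<n. F i) \<longlonglongrightarrow> Abs_fps (\<lambda>k. \<Sum>i<N k. fps_nth (F i) k)"
  proof (rule tendsto_fpsI)
    fix k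
    have "fps_nth (\<Sum>i<n. F i) k = (\<Sum>i<N k. fps_nth (F i) k)" if "n \<ge> N k" for n
      unfolding fps_sum_nth using that assms by (intro sum.mono_neutral_right) auto
    thus "\<forall>\<^sub>F n in sequentially. fps_nth (\<Sum>i<n. F i) k =
            fps_nth (Abs_fps (\<lambda>k. \<Sum>i<N k. fps_nth (F i) k)) k"
      by (auto intro: eventually_sequentiallyI)
  qed
  thus ?thesis unfolding summable_def sums_def by blast
qed

lemma summable_mock_theta_f:
  "summable (\<lambda>n. fps_X ^ (n\<^sup>2) / (qpoch (- fps_X) fps_X n)\<^sup>2 :: 'a::field_char_0 fps)"
proof (rule fps_summableI[where N = Suc])
  fix k n :: nat assume "n \<ge> Suc k"
  moreover have "n \<le> n\<^sup>2" by (simp add: power2_eq_square)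
  ultimately have kn: "k < n\<^sup>2" by linarith
  have "fps_nth (qpoch (- fps_X) fps_X n :: 'a fps) 0 = 1"
    unfolding qpoch_def by (induction n) simp_all
  hence "fps_nth ((qpoch (- fps_X) fps_X n)\<^sup>2 :: 'a fps) 0 \<noteq> 0"
    by (simp add: power2_eq_square)
  thus "fps_nth (fps_X ^ (n\<^sup>2) / (qpoch (- fps_X) fps_X n)\<^sup>2 :: 'a fps) k = 0"
    using kn by (simp add: fps_divide_unit fps_X_power_mult_nth)
qed

lemma summable_triangular:
  "summable (\<lambda>n. fps_X ^ (n * (n + 1) div 2) :: 'a::field_char_0 fps)"
proof (rule fps_summableI[where N = Suc])
  fix k n :: nat assume "n \<ge> Suc k"
  moreover have "n \<le> n * (n + 1) div 2" by (cases n) auto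
  ultimately show "fps_nth (fps_X ^ (n * (n + 1) div 2) :: 'a fps) k = 0" by simp
qed

lemma summable_hecke_sum:
  "summable (\<lambda>n. \<Sum>m = - int (n div 2)..int (n div 2).
     of_int (sgn1 m) * fps_X ^ hecke_exp n m :: 'a::field_char_0 fps)"
proof (rule fps_summableI[where N = "\<lambda>k. 4 * Suc k"])
  fix k n :: nat assume n: "n \<ge> 4 * Suc k"
  have "fps_nth (of_int (sgn1 m) * fps_X ^ hecke_exp n m :: 'a fps) k = 0"
    if "m \<in> {- int (n div 2)..int (n div 2)}" for m
    using hecke_exp_ge[OF that] n by (simp add: sgn1_def)
  thus "fps_nth (\<Sum>m = - int (n div 2)..int (n div 2).
          of_int (sgn1 m) * fps_X ^ hecke_exp n m :: 'a fps) k = 0"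
    unfolding fps_sum_nth by (intro sum.neutral) blast
qed

lemma has_prod_qpoch_inf:
  fixes i j :: nat
  assumes "i > 0" "j > 0"
  shows   "(\<lambda>k. 1 - fps_X ^ i * (fps_X ^ j) ^ k :: 'a::field_char_0 fps)
             has_prod qpoch_inf (fps_X ^ i) (fps_X ^ j)"
proof -
  define g :: "nat \<Rightarrow> 'a fps" where "g = (\<lambda>k. 1 - fps_X ^ i * (fps_X ^ j) ^ k)"
  define P where "P = (\<lambda>n. \<Prod>k<n. g k)"
  have g: "g k = 1 - fps_X ^ (i + j * k)" for k
    by (simp add: g_def power_add power_mult)
  have P0: "fps_nth (P n) 0 = 1" for n
    unfolding P_def by (induction n) (use assms in \<open>simp_all add: g\<close>)
  have "summable (\<lambda>n. P (Suc n) - P n)"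
  proof (rule fps_summableI[where N = Suc])
    fix k n :: nat assume "n \<ge> Suc k"
    moreover have "n \<le> i + j * n" using assms by (simp add: trans_le_add2)
    moreover have "P (Suc n) - P n = - (fps_X ^ (i + j * n) * P n)"
      by (simp add: P_def g algebra_simps)
    ultimately show "fps_nth (P (Suc n) - P n) k = 0"
      by (simp add: fps_X_power_mult_nth)
  qed
  then obtain s where "(\<lambda>n. \<Sum>k<n. P (Suc k) - P k) \<longlonglongrightarrow> s"
    unfolding summable_def sums_def by blast
  hence s: "(\<lambda>n. P n - P 0) \<longlonglongrightarrow> s" by (simp add: sum_lessThan_telescope)
  have lim: "P \<longlonglongrightarrow> s + 1"
    unfolding tendsto_fps_iff
  proof
    fix k
    show "\<forall>\<^sub>F n in sequentially. fps_nth (P n) k = fps_nth (s + 1) k"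
      using s[unfolded tendsto_fps_iff, rule_format, of k]
      by eventually_elim (auto simp: P_def algebra_simps)
  qed
  have "\<forall>\<^sub>F n in sequentially. fps_nth (P n) 0 = fps_nth (s + 1) 0"
    using lim unfolding tendsto_fps_iff by blast
  hence "fps_nth (s + 1) 0 = 1" by (auto simp: P0 eventually_sequentially)
  hence "s + 1 \<noteq> 0" by (metis fps_zero_nth zero_neq_one)
  hence "raw_has_prod g 0 (s + 1)"
    using LIMSEQ_Suc[OF lim] by (simp add: raw_has_prod_def P_def lessThan_Suc_atMost)
  hence "g has_prod (s + 1)" by (simp add: has_prod_def)
  moreover from this have "prodinf g = s + 1" by (rule has_prod_unique[symmetric])
  ultimately show ?thesis by (simp add: qpoch_inf_def g_def)
qed

end

theory Submission
  imports Defs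
begin

text \<open>
  Write $(q)_n = (q;q)_n$ and $T_k = k(k+1)/2$. Since
  $1/(-q;q)_n = (-q^{n+1};q)_\infty / (-q;q)_\infty$, Euler's expansion of $(-q^{n+1};q)_\infty$ turns
  $(-q;q)_\infty^2 f(q)$ into a triple sum over $n$ and the two Euler indices. Collecting terms by the
  difference $k$ of the two indices and putting $N = n + j$, where $j$ is the smaller index, gives
  $\sum_{k \in \mathbf Z} q^{T_{|k|}} t_{|k|}$ with
  $t_k = \sum_N q^{N^2+Nk} \sum_{j \le N} q^j / ((q)_j (q)_{j+k})$. The inner sums telescope against
  each other, so that $t_k = (1 - q^{2k+2}) / (q)_\infty + q^{3k+4} t_{k+2}$. Hence $(q)_\infty t_k$ is
  a false theta series, and the resulting double sum is the Hecke sum cut in two along the fixed line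
  of an automorph of its quadratic form. The same expansion of $(-1;q)_\infty (-q;q)_\infty$ proves
  Gauss's formula $\sum_n q^{T_n} = (-q;q)_\infty^2 (q)_\infty$, which links the two forms of the theorem.
\<close>

section \<open>Locally finite sums of formal power series\<close>

text \<open>Index sets such as pairs carry no preferred order of summation. Local finiteness reduces
  every rearrangement to finite sums, degree by degree.\<close>

definition locfin :: "('i \<Rightarrow> 'a::comm_ring_1 fps) \<Rightarrow> 'i set \<Rightarrow> bool" where
  "locfin F A \<longleftrightarrow> (\<forall>k. finite {i \<in> A. fps_nth (F i) k \<noteq> 0})"

text \<open>In a degree with infinite support the coefficient is the default 0 of
  \<open>sum\<close>, a case that \<open>locfin\<close> rules out.\<close>

definition fpsum :: "('i \<Rightarrow> 'a::comm_ring_1 fps) \<Rightarrow> 'i set \<Rightarrow> 'a fps" where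
  "fpsum F A = Abs_fps (\<lambda>k. \<Sum>i | i \<in> A \<and> fps_nth (F i) k \<noteq> 0. fps_nth (F i) k)"

text \<open>\<open>B\<close> may exceed the support, so that several families can be evaluated over
  one common finite set.\<close>

lemma fpsum_nth:
  assumes "finite B" "B \<subseteq> A" "\<And>i. i \<in> A - B \<Longrightarrow> fps_nth (F i) k = 0"
  shows   "fps_nth (fpsum F A) k = (\<Sum>i\<in>B. fps_nth (F i) k)"
  unfolding fpsum_def fps_nth_Abs_fps
  using assms by (intro sum.mono_neutral_left) auto

lemma fpsum_nth_support:
  "fps_nth (fpsum F A) k = (\<Sum>i | i \<in> A \<and> fps_nth (F i) k \<noteq> 0. fps_nth (F i) k)"
  by (simp add: fpsum_def)

lemma locfin_subset: "locfin F A \<Longrightarrow> B \<subseteq> A \<Longrightarrow> locfin F B"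
  unfolding locfin_def by (auto intro: rev_finite_subset)

lemma locfin_power:
  assumes "\<And>k. finite {i \<in> A. e i \<le> k}"
  shows   "locfin (\<lambda>i. fps_X ^ e i * c i) A"
  unfolding locfin_def
proof
  fix k
  show "finite {i \<in> A. fps_nth (fps_X ^ e i * c i) k \<noteq> 0}"
    by (rule finite_subset[OF _ assms[of k]]) (auto simp: fps_X_power_mult_nth split: if_splits)
qed

text \<open>The slack \<open>b\<close> is there for Euler's exponent \<open>a choose 2\<close>,
  which vanishes at a = 1.\<close>

lemma locfin_power_nat:
  fixes e :: "nat \<Rightarrow> nat"
  assumes "\<And>i. i \<le> e i + b"
  shows   "locfin (\<lambda>i. fps_X ^ e i * c i) A"
proof (rule locfin_power)
  fix k
  have "{i \<in> A. e i \<le> k} \<subseteq> {..k + b}"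
    using assms by (auto intro: order.trans[OF assms])
  thus "finite {i \<in> A. e i \<le> k}" by (rule finite_subset) auto
qed

lemma fpsum_cong: "(\<And>i. i \<in> A \<Longrightarrow> F i = G i) \<Longrightarrow> fpsum F A = fpsum G A"
  unfolding fpsum_def by (intro arg_cong[of _ _ Abs_fps] ext sum.cong) auto

lemma fpsum_reindex:
  assumes "bij_betw h A B"
  shows   "fpsum F B = fpsum (\<lambda>i. F (h i)) A"
proof (rule fps_ext)
  fix k
  have "bij_betw h {i. i \<in> A \<and> fps_nth (F (h i)) k \<noteq> 0} {i. i \<in> B \<and> fps_nth (F i) k \<noteq> 0}"
    using assms by (auto simp: bij_betw_def inj_on_def)
  thus "fps_nth (fpsum F B) k = fps_nth (fpsum (\<lambda>i. F (h i)) A) k"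
    unfolding fpsum_nth_support by (rule sum.reindex_bij_betw[symmetric])
qed

lemma locfin_reindex:
  assumes "bij_betw h A B" "locfin F B"
  shows   "locfin (\<lambda>i. F (h i)) A"
  unfolding locfin_def
proof
  fix k
  have "bij_betw h {i \<in> A. fps_nth (F (h i)) k \<noteq> 0} {i \<in> B. fps_nth (F i) k \<noteq> 0}"
    using assms(1) by (auto simp: bij_betw_def inj_on_def)
  thus "finite {i \<in> A. fps_nth (F (h i)) k \<noteq> 0}"
    using assms(2) bij_betw_finite unfolding locfin_def by blast
qed

lemma fpsum_add:
  assumes "locfin F A" "locfin G A"
  shows   "fpsum (\<lambda>i. F i + G i) A = fpsum F A + fpsum G A"
proof (rule fps_ext)
  fix k
  define B where "B = {i \<in> A. fps_nth (F i) k \<noteq> 0} \<union> {i \<in> A. fps_nth (G i) k \<noteq> 0}"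
  have B: "finite B" "B \<subseteq> A" using assms by (auto simp: B_def locfin_def)
  have "fps_nth (fpsum H A) k = (\<Sum>i\<in>B. fps_nth (H i) k)"
    if "H = F \<or> H = G \<or> H = (\<lambda>i. F i + G i)" for H
    by (rule fpsum_nth[OF B]) (use that in \<open>auto simp: B_def\<close>)
  thus "fps_nth (fpsum (\<lambda>i. F i + G i) A) k = fps_nth (fpsum F A + fpsum G A) k"
    by (simp add: sum.distrib)
qed

text \<open>A nonzero coefficient of degree k in \<open>F i * G j\<close> forces nonzero
  coefficients of both factors in degrees at most k.\<close>

lemma locfin_mult:
  assumes "locfin F A" "locfin G B"
  shows   "locfin (\<lambda>(i, j). F i * G j) (A \<times> B)"
  unfolding locfin_def
proof
  fix k
  have "{p \<in> A \<times> B. fps_nth (case p of (i, j) \<Rightarrow> F i * G j) k \<noteq> 0} \<subseteq>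
          (\<Union>l\<le>k. {i \<in> A. fps_nth (F i) l \<noteq> 0}) \<times> (\<Union>l\<le>k. {j \<in> B. fps_nth (G j) l \<noteq> 0})"
  proof safe
    fix i j assume *: "fps_nth (F i * G j) k \<noteq> 0" "i \<in> A" "j \<in> B"
    obtain l where "l \<in> {0..k}" "fps_nth (F i) l * fps_nth (G j) (k - l) \<noteq> 0"
      using *(1) unfolding fps_mult_nth by (rule sum.not_neutral_contains_not_neutral)
    hence "l \<le> k" "fps_nth (F i) l \<noteq> 0" "fps_nth (G j) (k - l) \<noteq> 0" by auto
    thus "i \<in> (\<Union>l\<le>k. {i \<in> A. fps_nth (F i) l \<noteq> 0})" "j \<in> (\<Union>l\<le>k. {j \<in> B. fps_nth (G j) l \<noteq> 0})"
      using *(2,3) diff_le_self[of k l] by blast+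
  qed
  moreover have "finite (\<Union>l\<le>k. {i \<in> A. fps_nth (F i) l \<noteq> 0})" "finite (\<Union>l\<le>k. {j \<in> B. fps_nth (G j) l \<noteq> 0})"
    using assms by (auto simp: locfin_def)
  ultimately show "finite {p \<in> A \<times> B. fps_nth (case p of (i, j) \<Rightarrow> F i * G j) k \<noteq> 0}"
    by (meson finite_SigmaI finite_subset)
qed

lemma fpsum_cmult:
  assumes "locfin F A"
  shows   "fpsum (\<lambda>i. c * F i) A = c * fpsum F A"
proof (rule fps_ext)
  fix k
  \<comment> \<open>The product with \<open>c\<close> involves all degrees up to k, so
    \<open>B\<close> collects the supports in all of them.\<close>
  define B where "B = (\<Union>l\<le>k. {i \<in> A. fps_nth (F i) l \<noteq> 0})"
  have B: "finite B" "B \<subseteq> A" using assms by (auto simp: B_def locfin_def)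
  have Fk: "fps_nth (fpsum F A) l = (\<Sum>i\<in>B. fps_nth (F i) l)" if "l \<le> k" for l
    by (rule fpsum_nth[OF B]) (use that in \<open>auto simp: B_def\<close>)
  have "fps_nth (c * F i) k = 0" if "i \<in> A - B" for i
    unfolding fps_mult_nth by (rule sum.neutral) (use that in \<open>auto simp: B_def\<close>)
  hence "fps_nth (fpsum (\<lambda>i. c * F i) A) k = (\<Sum>i\<in>B. fps_nth (c * F i) k)"
    by (intro fpsum_nth[OF B]) auto
  also have "\<dots> = fps_nth (c * fpsum F A) k"
    unfolding fps_mult_nth by (subst sum.swap) (simp add: Fk sum_distrib_left)
  finally show "fps_nth (fpsum (\<lambda>i. c * F i) A) k = fps_nth (c * fpsum F A) k" .
qed

lemma locfin_cmult:
  assumes "locfin F A"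
  shows   "locfin (\<lambda>i. c * F i) A"
proof -
  have "locfin (\<lambda>_. c) {()}" by (simp add: locfin_def)
  from locfin_mult[OF this assms] have "locfin (\<lambda>(i, j). c * F j) ({()} \<times> A)" .
  from locfin_reindex[OF _ this, of "Pair ()" A] show ?thesis
    by (simp add: bij_betw_def inj_on_def image_def) auto
qed

lemma fpsum_minus:
  fixes F G :: "'i \<Rightarrow> 'a::comm_ring_1 fps"
  assumes "locfin F A" "locfin G A"
  shows   "fpsum (\<lambda>i. F i - G i) A = fpsum F A - fpsum G A"
  using fpsum_add[OF assms(1) locfin_cmult[OF assms(2), of "-1"]] fpsum_cmult[OF assms(2), of "-1"]
  by simp

lemma fpsum_Un_disjoint:
  assumes "locfin F (A \<union> B)" "A \<inter> B = {}"
  shows   "fpsum F (A \<union> B) = fpsum F A + fpsum F B"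
proof (rule fps_ext)
  fix k
  have fin: "finite {i \<in> A. fps_nth (F i) k \<noteq> 0}" "finite {i \<in> B. fps_nth (F i) k \<noteq> 0}"
    using locfin_subset[OF assms(1), of A] locfin_subset[OF assms(1), of B]
    by (auto simp: locfin_def)
  have "{i. i \<in> A \<union> B \<and> fps_nth (F i) k \<noteq> 0} =
          {i \<in> A. fps_nth (F i) k \<noteq> 0} \<union> {i \<in> B. fps_nth (F i) k \<noteq> 0}" by auto
  thus "fps_nth (fpsum F (A \<union> B)) k = fps_nth (fpsum F A + fpsum F B) k"
    using assms(2) unfolding fpsum_nth_support fps_add_nth
    by (simp add: sum.union_disjoint[OF fin] disjoint_iff)
qed

lemma fpsum_finite: "finite A \<Longrightarrow> fpsum F A = sum F A"
  by (rule fps_ext, subst fpsum_nth[of A]) (auto simp: fps_sum_nth)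

lemma fpsum_Suc:
  assumes "locfin F (UNIV :: nat set)"
  shows   "fpsum F UNIV = F 0 + fpsum (\<lambda>n. F (Suc n)) UNIV"
proof -
  have U: "(UNIV :: nat set) = {0} \<union> range Suc" using not0_implies_Suc by auto
  have "fpsum F ({0} \<union> range Suc) = fpsum F {0} + fpsum F (range Suc)"
    by (rule fpsum_Un_disjoint) (use assms U in auto)
  moreover have "fpsum F (range Suc) = fpsum (\<lambda>n. F (Suc n)) UNIV"
    by (rule fpsum_reindex) (simp add: bij_betw_def)
  ultimately show ?thesis using U by (simp add: fpsum_finite)
qed

text \<open>Fubini for locally finite sums. The second claim allows further operations on the outer
  sum.\<close>

lemma fpsum_Sigma:
  assumes "locfin (\<lambda>(i, j). F i j) (Sigma A B)"
  shows   "fpsum (\<lambda>(i, j). F i j) (Sigma A B) = fpsum (\<lambda>i. fpsum (F i) (B i)) A"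
    and   "locfin (\<lambda>i. fpsum (F i) (B i)) A"
proof -
  define P where "P = (\<lambda>k. {p \<in> Sigma A B. fps_nth (case p of (i, j) \<Rightarrow> F i j) k \<noteq> 0})"
  define C where "C = (\<lambda>k i. {j \<in> B i. fps_nth (F i j) k \<noteq> 0})"
  have finP: "finite (P k)" for k using assms by (simp add: P_def locfin_def)
  \<comment> \<open>The support in degree k consists of its fibres over its projection, which
    reduces the claim to \<open>sum.Sigma\<close>.\<close>
  have P: "P k = Sigma (fst ` P k) (C k)" for k by (auto simp: P_def C_def intro: rev_image_eqI)
  have finC: "finite (C k i)" if "i \<in> fst ` P k" for k i
    by (rule finite_subset[OF _ finite_imageI[OF finP[of k], of snd]])
       (use that in \<open>force simp: P_def C_def image_iff\<close>)
  have inner: "fps_nth (fpsum (F i) (B i)) k = (\<Sum>j\<in>C k i. fps_nth (F i j) k)" for i k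
    by (simp add: fpsum_nth_support C_def)
  have zero: "fps_nth (fpsum (F i) (B i)) k = 0" if "i \<in> A - fst ` P k" for i k
  proof -
    have "C k i = {}" using that by (auto simp: C_def P_def image_iff)
    thus ?thesis by (simp add: inner)
  qed
  have sub: "fst ` P k \<subseteq> A" for k by (auto simp: P_def)
  show "locfin (\<lambda>i. fpsum (F i) (B i)) A"
    unfolding locfin_def
  proof
    fix k
    show "finite {i \<in> A. fps_nth (fpsum (F i) (B i)) k \<noteq> 0}"
      by (rule finite_subset[OF _ finite_imageI[OF finP[of k], of fst]]) (use zero in blast)
  qed
  show "fpsum (\<lambda>(i, j). F i j) (Sigma A B) = fpsum (\<lambda>i. fpsum (F i) (B i)) A"
  proof (rule fps_ext)
    fix k
    have "fps_nth (fpsum (\<lambda>(i, j). F i j) (Sigma A B)) k =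
            (\<Sum>p\<in>P k. fps_nth (case p of (i, j) \<Rightarrow> F i j) k)"
      by (rule fpsum_nth[OF finP]) (auto simp: P_def)
    also have "\<dots> = (\<Sum>(i, j)\<in>Sigma (fst ` P k) (C k). fps_nth (F i j) k)"
      by (subst P) (simp add: case_prod_unfold)
    also have "\<dots> = (\<Sum>i\<in>fst ` P k. \<Sum>j\<in>C k i. fps_nth (F i j) k)"
      by (rule sum.Sigma[symmetric]) (use finP finC in auto)
    also have "\<dots> = fps_nth (fpsum (\<lambda>i. fpsum (F i) (B i)) A) k"
      by (subst fpsum_nth[OF finite_imageI[OF finP] sub[of k]]) (use zero in \<open>auto simp: inner\<close>)
    finally show "fps_nth (fpsum (\<lambda>(i, j). F i j) (Sigma A B)) k =
                    fps_nth (fpsum (\<lambda>i. fpsum (F i) (B i)) A) k" .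
  qed
qed

lemma fpsum_mult:
  assumes "locfin F A" "locfin G B"
  shows   "fpsum F A * fpsum G B = fpsum (\<lambda>(i, j). F i * G j) (A \<times> B)"
proof -
  have "fpsum (\<lambda>(i, j). F i * G j) (A \<times> B) = fpsum (\<lambda>i. fpsum (\<lambda>j. F i * G j) B) A"
    by (rule fpsum_Sigma) (rule locfin_mult[OF assms])
  also have "\<dots> = fpsum (\<lambda>i. fpsum G B * F i) A"
    by (simp add: fpsum_cmult[OF assms(2)] mult.commute)
  also have "\<dots> = fpsum G B * fpsum F A"
    by (rule fpsum_cmult[OF assms(1)])
  finally show ?thesis by (simp add: mult.commute)
qed

text \<open>Bridge to the sums in the theorem: past the last index of the support in degree k, the
  partial sums no longer change there.\<close>

lemma suminf_eq_fpsum: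
  fixes F :: "nat \<Rightarrow> 'a::comm_ring_1 fps"
  assumes "locfin F UNIV"
  shows   "suminf F = fpsum F UNIV"
proof -
  have "(\<lambda>n. \<Sum>i<n. F i) \<longlonglongrightarrow> fpsum F UNIV"
  proof (rule tendsto_fpsI)
    fix k
    have "finite {i. fps_nth (F i) k \<noteq> 0}" using assms by (auto simp: locfin_def)
    then obtain N where N: "\<And>i. fps_nth (F i) k \<noteq> 0 \<Longrightarrow> i < N"
      unfolding finite_nat_set_iff_bounded by blast
    have "fps_nth (\<Sum>i<n. F i) k = fps_nth (fpsum F UNIV) k" if "n \<ge> N" for n
      unfolding fps_sum_nth using N that by (intro fpsum_nth[symmetric]) force+
    thus "\<forall>\<^sub>F n in sequentially. fps_nth (\<Sum>i<n. F i) k = fps_nth (fpsum F UNIV) k"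
      by (auto intro: eventually_sequentiallyI)
  qed
  thus ?thesis using sums_unique unfolding sums_def by metis
qed

text \<open>Iterating the hypothesis shows that every power of $q$ divides every \<open>d k\<close>.\<close>

lemma fps_recursion_zero:
  fixes d :: "'i \<Rightarrow> 'a::comm_ring_1 fps"
  assumes "\<And>k. \<exists>c l. d k = fps_X * c * d l"
  shows   "d k = 0"
proof -
  have "fps_nth (d k) n = 0" for n
  proof (induction n arbitrary: k rule: less_induct)
    case (less n)
    obtain c l where *: "d k = fps_X * (c * d l)" using assms[of k] by (auto simp: mult.assoc)
    show ?case
    proof (cases n)
      case (Suc m)
      have "fps_nth (c * d l) m = 0"
        unfolding fps_mult_nth by (rule sum.neutral) (use less Suc in auto)
      thus ?thesis by (simp add: * Suc)
    qed (simp add: *)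
  qed
  thus ?thesis by (simp add: fps_eq_iff)
qed

section \<open>Euler's sum and the Durfee sum\<close>

lemma tendsto_fps_mult:
  fixes f g :: "nat \<Rightarrow> 'a::comm_ring_1 fps"
  assumes "f \<longlonglongrightarrow> a" "g \<longlonglongrightarrow> b"
  shows   "(\<lambda>n. f n * g n) \<longlonglongrightarrow> a * b"
proof (rule tendsto_fpsI)
  fix k
  have "\<forall>\<^sub>F n in sequentially. \<forall>i\<in>{0..k}. fps_nth (f n) i = fps_nth a i"
       "\<forall>\<^sub>F n in sequentially. \<forall>i\<in>{0..k}. fps_nth (g n) i = fps_nth b i"
    using assms unfolding tendsto_fps_iff by (intro eventually_ball_finite; simp)+
  thus "\<forall>\<^sub>F n in sequentially. fps_nth (f n * g n) k = fps_nth (a * b) k"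
    by eventually_elim (simp add: fps_mult_nth)
qed

text \<open>Serves for Euler's sum and the Durfee sum, where splitting off the first term leaves a
  multiple of q^(n+1).\<close>

lemma tendsto_fps_one_plus:
  fixes g :: "nat \<Rightarrow> 'a::comm_ring_1 fps"
  assumes "\<And>n. \<exists>r. g n = 1 + fps_X ^ Suc n * r"
  shows   "g \<longlonglongrightarrow> 1"
proof (rule tendsto_fpsI)
  fix k
  have "fps_nth (g n) k = fps_nth 1 k" if n: "n \<ge> k" for n
  proof -
    obtain r where "g n = 1 + fps_X ^ Suc n * r" using assms by blast
    thus ?thesis using n by (simp only: fps_add_nth fps_X_power_mult_nth) simp
  qed
  thus "\<forall>\<^sub>F n in sequentially. fps_nth (g n) k = fps_nth 1 k"
    by (rule eventually_sequentiallyI)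
qed

lemma qpoch_tendsto:
  fixes i :: nat
  assumes "i > 0"
  shows   "(\<lambda>n. qpoch (fps_X ^ i) (fps_X ^ i) n :: 'a::field_char_0 fps)
             \<longlonglongrightarrow> qpoch_inf (fps_X ^ i) (fps_X ^ i)"
  using has_prod_imp_tendsto'[OF has_prod_qpoch_inf[OF assms assms]] by (simp add: qpoch_def)

section \<open>Reciprocals of (q;q)_n and Euler's expansion\<close>

definition iq :: "nat \<Rightarrow> 'a::field_char_0 fps" where
  "iq n = inverse (qpoch fps_X fps_X n)"

lemma qpoch_nth_0: "fps_nth (qpoch fps_X fps_X n :: 'a::field_char_0 fps) 0 = 1"
  unfolding qpoch_def by (induction n) simp_all

lemma qpoch_neg_nth_0: "fps_nth (qpoch (- fps_X) fps_X n :: 'a::field_char_0 fps) 0 = 1"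
  unfolding qpoch_def by (induction n) simp_all

lemma iq_0 [simp]: "iq 0 = 1"
  by (simp add: iq_def qpoch_def)

lemma iq_mult_qpoch: "iq n * qpoch fps_X fps_X n = 1"
  unfolding iq_def by (rule inverse_mult_eq_1) (simp add: qpoch_nth_0)

text \<open>Raising the index produces a polynomial factor instead of a quotient, so later
  identities need only ring arithmetic.\<close>

lemma iq_Suc: "iq n = (1 - fps_X ^ Suc n) * iq (Suc n)"
proof -
  have "qpoch fps_X fps_X (Suc n) = qpoch fps_X fps_X n * (1 - fps_X ^ Suc n :: 'a fps)"
    by (simp add: qpoch_def)
  hence "iq (Suc n) = iq n * inverse (1 - fps_X ^ Suc n :: 'a fps)"
    by (simp only: iq_def fps_inverse_mult)
  moreover have "inverse (1 - fps_X ^ Suc n :: 'a fps) * (1 - fps_X ^ Suc n) = 1"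
    by (rule inverse_mult_eq_1) simp
  ultimately show ?thesis by (simp add: mult_ac)
qed

lemma choose_two_Suc: "Suc n choose 2 = (n choose 2) + n"
  by (simp add: numeral_2_eq_2)

text \<open>Polarisation of the triangular numbers; it separates the smaller index from the
  difference in products of Euler sums.\<close>

lemma choose_two_add: "(m + n) choose 2 = (m choose 2) + (n choose 2) + m * n"
  by (induction m) (simp_all add: choose_two_Suc)

lemma double_choose_two_Suc: "2 * (Suc n choose 2) = n * (n + 1)"
  by (induction n) (simp_all add: choose_two_Suc)

lemma choose_two_Suc_ge: "n \<le> Suc n choose 2"
  by (simp add: choose_two_Suc)

text \<open>Euler's expansion of (-q^c;q)_inf. The infinite product itself never appears:
  \<open>euler_sum_rec\<close> and the limit 1 of \<open>euler_sum (Suc n)\<close> replace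
  it.\<close>

definition euler_sum :: "nat \<Rightarrow> 'a::field_char_0 fps" where
  "euler_sum c = fpsum (\<lambda>a. fps_X ^ ((a choose 2) + c * a) * iq a) UNIV"

lemma locfin_euler: "locfin (\<lambda>a. fps_X ^ ((a choose 2) + e a) * F a) UNIV"
proof (rule locfin_power_nat)
  show "a \<le> (a choose 2) + e a + 1" for a
    by (cases a) (use choose_two_Suc in auto)
qed

text \<open>Mirrors (-q^c;q)_inf = (1 + q^c) (-q^(c+1);q)_inf. The difference of two terms carries 1
  - q^a, which cancels the last factor of (q;q)_a.\<close>

lemma euler_sum_rec:
  "euler_sum c = (1 + fps_X ^ c) * (euler_sum (Suc c) :: 'a::field_char_0 fps)"
proof -
  have "euler_sum c - euler_sum (Suc c) =
          fpsum (\<lambda>a. fps_X ^ ((a choose 2) + c * a) * ((1 - fps_X ^ a) * iq a :: 'a fps)) UNIV"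
    unfolding euler_sum_def
    by (subst fpsum_minus[symmetric, OF locfin_euler locfin_euler], rule fpsum_cong)
       (simp add: power_add algebra_simps)
  \<comment> \<open>The term a = 0 vanishes with 1 - q^0, and a is replaced by a + 1.\<close>
  also have "\<dots> = fpsum (\<lambda>a. fps_X ^ c * (fps_X ^ ((a choose 2) + Suc c * a) * iq a)) UNIV"
    by (subst fpsum_Suc[OF locfin_euler], simp add: iq_Suc[symmetric] del: power_Suc)
       (rule fpsum_cong, simp add: choose_two_Suc power_add algebra_simps)
  also have "\<dots> = fps_X ^ c * euler_sum (Suc c)"
    unfolding euler_sum_def by (rule fpsum_cmult[OF locfin_euler])
  finally show ?thesis by (simp add: algebra_simps)
qed

lemma euler_sum_Suc_tendsto: "(\<lambda>n. euler_sum (Suc n)) \<longlonglongrightarrow> (1 :: 'a::field_char_0 fps)"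
proof (rule tendsto_fps_one_plus)
  fix n
  have "euler_sum (Suc n) = 1 + fpsum (\<lambda>a. fps_X ^ ((Suc a choose 2) + Suc n * Suc a) * iq (Suc a)) UNIV"
    unfolding euler_sum_def by (subst fpsum_Suc[OF locfin_euler]) (simp add: numeral_2_eq_2)
  also have "fpsum (\<lambda>a. fps_X ^ ((Suc a choose 2) + Suc n * Suc a) * (iq (Suc a) :: 'a fps)) UNIV =
               fpsum (\<lambda>a. fps_X ^ Suc n * (fps_X ^ ((a choose 2) + (a + Suc n * a)) * iq (Suc a))) UNIV"
    by (rule fpsum_cong) (simp add: choose_two_Suc power_add algebra_simps)
  also have "\<dots> = fps_X ^ Suc n * fpsum (\<lambda>a. fps_X ^ ((a choose 2) + (a + Suc n * a)) * iq (Suc a)) UNIV"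
    by (rule fpsum_cmult[OF locfin_euler])
  finally show "\<exists>r. euler_sum (Suc n) = 1 + fps_X ^ Suc n * (r :: 'a fps)" by blast
qed

text \<open>The form of 1/(-q;q)_n = (-q^(n+1);q)_inf / (-q;q)_inf through which the denominators of
  f are removed.\<close>

lemma euler_sum_1_eq:
  "(euler_sum 1 :: 'a::field_char_0 fps) = qpoch (- fps_X) fps_X n * euler_sum (Suc n)"
proof (induction n)
  case (Suc n)
  thus ?case using euler_sum_rec[of "Suc n", where 'a = 'a] by (simp add: qpoch_def mult.assoc)
qed (simp add: qpoch_def)

lemma euler_sum_1_nth_0: "fps_nth (euler_sum 1 :: 'a::field_char_0 fps) 0 = 1"
proof -
  have "\<forall>\<^sub>F n in sequentially. fps_nth (euler_sum (Suc n) :: 'a fps) 0 = 1"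
    using euler_sum_Suc_tendsto[where 'a = 'a] unfolding tendsto_fps_iff by (metis fps_one_nth)
  then obtain n where "fps_nth (euler_sum (Suc n) :: 'a fps) 0 = 1"
    by (auto simp: eventually_sequentially)
  thus ?thesis by (subst euler_sum_1_eq[of n]) (simp add: qpoch_neg_nth_0)
qed

text \<open>The limit of (q^2;q^2)_n = (q;q)_n (-q;q)_n. Multiplying by
  \<open>euler_sum (Suc n)\<close>, which tends to 1, turns (-q;q)_n into the constant
  \<open>euler_sum 1\<close>.\<close>

lemma qpoch_inf_X2:
  "qpoch_inf (fps_X\<^sup>2) (fps_X\<^sup>2) = qpoch_inf fps_X fps_X * (euler_sum 1 :: 'a::field_char_0 fps)"
proof (rule LIMSEQ_unique)
  have "qpoch (fps_X\<^sup>2) (fps_X\<^sup>2) n = qpoch fps_X fps_X n * (qpoch (- fps_X) fps_X n :: 'a fps)" for n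
    unfolding qpoch_def prod.distrib[symmetric]
    by (rule prod.cong) (simp_all add: algebra_simps power_mult_distrib power2_eq_square)
  hence *: "qpoch (fps_X\<^sup>2) (fps_X\<^sup>2) n * euler_sum (Suc n) = qpoch fps_X fps_X n * (euler_sum 1 :: 'a fps)" for n
    by (subst euler_sum_1_eq[of n]) (simp add: mult.assoc)
  show "(\<lambda>n. qpoch fps_X fps_X n * (euler_sum 1 :: 'a fps)) \<longlonglongrightarrow> qpoch_inf (fps_X\<^sup>2) (fps_X\<^sup>2)"
    using tendsto_fps_mult[OF qpoch_tendsto[of 2] euler_sum_Suc_tendsto[where 'a = 'a]]
    by (simp add: *)
  show "(\<lambda>n. qpoch fps_X fps_X n * (euler_sum 1 :: 'a fps)) \<longlonglongrightarrow> qpoch_inf fps_X fps_X * euler_sum 1"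
    using tendsto_fps_mult[OF qpoch_tendsto[of 1] tendsto_const] by simp
qed

text \<open>Partitions sorted by their largest rectangle of size j by j + k, the Durfee square if k
  = 0. Every k therefore gives 1/(q;q)_inf.\<close>

definition durfee_sum :: "nat \<Rightarrow> 'a::field_char_0 fps" where
  "durfee_sum k = fpsum (\<lambda>j. fps_X ^ (j * (j + k)) * (iq j * iq (j + k))) UNIV"

lemma locfin_square: "locfin (\<lambda>j. fps_X ^ (j * (j + k)) * F j) (A :: nat set)"
proof (rule locfin_power_nat)
  show "j \<le> j * (j + k) + 0" for j by (cases j) auto
qed

text \<open>The factor 1 - q^j kills the term j = 0 and cancels against 1/(q;q)_j; after the shift,
  (j+1)(j+1+k) = (k+1) + j(j+k+2).\<close>

lemma durfee_shift:
  "fpsum (\<lambda>j. fps_X ^ (j * (j + k)) * ((1 - fps_X ^ j) * iq j * iq (j + k + 1))) UNIV =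
     fps_X ^ (k + 1) * (durfee_sum (k + 2) :: 'a::field_char_0 fps)"
proof -
  have e: "fps_X ^ (Suc j * (Suc j + k)) * ((1 - fps_X ^ Suc j) * iq (Suc j) * iq (Suc j + k + 1)) =
          fps_X ^ (k + 1) * (fps_X ^ (j * (j + (k + 2))) * (iq j * (iq (j + (k + 2)) :: 'a fps)))" for j
  proof -
    have "Suc j * (Suc j + k) = (k + 1) + j * (j + (k + 2))" by (simp add: algebra_simps)
    thus ?thesis by (simp only: iq_Suc[of j, symmetric] power_add) (simp add: mult.assoc)
  qed
  show ?thesis unfolding durfee_sum_def
    by (subst fpsum_Suc[OF locfin_square]) (simp only: e fpsum_cmult[OF locfin_square], simp)
qed

text \<open>Write 1 = q^j + (1 - q^j): the first part completes the exponent to j(j+k+1), the second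
  is \<open>durfee_shift\<close>.\<close>

lemma durfee_mixed:
  "fpsum (\<lambda>j. fps_X ^ (j * (j + k)) * (iq j * iq (j + k + 1))) UNIV =
     durfee_sum (k + 1) + fps_X ^ (k + 1) * (durfee_sum (k + 2) :: 'a::field_char_0 fps)"
proof -
  have "fpsum (\<lambda>j. fps_X ^ (j * (j + k)) * (iq j * iq (j + k + 1) :: 'a fps)) UNIV =
          fpsum (\<lambda>j. fps_X ^ (j * (j + (k + 1))) * (iq j * iq (j + (k + 1))) +
                     fps_X ^ (j * (j + k)) * ((1 - fps_X ^ j) * iq j * iq (j + k + 1))) UNIV"
    by (rule fpsum_cong) (simp add: power_add algebra_simps)
  also have "\<dots> = durfee_sum (k + 1) + fps_X ^ (k + 1) * durfee_sum (k + 2)"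
    by (subst fpsum_add[OF locfin_square locfin_square]) (simp only: durfee_shift durfee_sum_def)
  finally show ?thesis .
qed

text \<open>Expanding 1/(q;q)_(j+k) by \<open>iq_Suc\<close> leads to \<open>durfee_mixed\<close>.
  The result is shaped for \<open>fps_recursion_zero\<close>.\<close>

lemma durfee_sum_diff:
  "durfee_sum k - durfee_sum (k + 1) =
     - (fps_X ^ (k + 1) * (durfee_sum (k + 1) - durfee_sum (k + 2) :: 'a::field_char_0 fps))"
proof -
  have "durfee_sum k =
          fpsum (\<lambda>j. fps_X ^ (j * (j + k)) * (iq j * iq (j + k + 1)) -
             fps_X ^ (k + 1) * (fps_X ^ (j * (j + (k + 1))) * (iq j * (iq (j + (k + 1)) :: 'a fps)))) UNIV"
    unfolding durfee_sum_def
    by (rule fpsum_cong, subst iq_Suc[of "_ + k"]) (simp add: power_add algebra_simps)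
  also have "\<dots> = fpsum (\<lambda>j. fps_X ^ (j * (j + k)) * (iq j * iq (j + k + 1))) UNIV -
                  fps_X ^ (k + 1) * durfee_sum (k + 1)"
    unfolding durfee_sum_def
    by (subst fpsum_minus[OF locfin_square locfin_cmult[OF locfin_square]])
       (simp only: fpsum_cmult[OF locfin_square])
  finally show ?thesis unfolding durfee_mixed by (simp add: algebra_simps)
qed

lemma durfee_sum_const: "durfee_sum k = (durfee_sum 0 :: 'a::field_char_0 fps)"
proof -
  define d :: "nat \<Rightarrow> 'a fps" where "d k = durfee_sum k - durfee_sum (k + 1)" for k
  have "d k = fps_X * (- (fps_X ^ k)) * d (k + 1)" for k
    using durfee_sum_diff[of k, where 'a = 'a] by (simp add: d_def)
  hence "d k = 0" for k by (intro fps_recursion_zero) blast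
  thus ?thesis by (induction k) (simp_all add: d_def)
qed

lemma durfee_sum_eq: "durfee_sum k * qpoch_inf fps_X fps_X = (1 :: 'a::field_char_0 fps)"
proof (rule LIMSEQ_unique)
  show "(\<lambda>n. durfee_sum k * qpoch fps_X fps_X n) \<longlonglongrightarrow> durfee_sum k * (qpoch_inf fps_X fps_X :: 'a fps)"
    using tendsto_fps_mult[OF tendsto_const qpoch_tendsto[of 1]] by simp
  show "(\<lambda>n. durfee_sum k * qpoch fps_X fps_X n) \<longlonglongrightarrow> (1 :: 'a fps)"
  proof (rule tendsto_fps_one_plus)
    fix n
    define r :: "'a fps" where
      "r = fpsum (\<lambda>j. fps_X ^ (j * (j + (n + 2))) * (iq (Suc j) * iq (Suc j + n))) UNIV"
    have "durfee_sum n = iq n + fpsum (\<lambda>j. fps_X ^ Suc n *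
            (fps_X ^ (j * (j + (n + 2))) * (iq (Suc j) * (iq (Suc j + n) :: 'a fps)))) UNIV"
    proof -
      have "Suc j * (Suc j + n) = Suc n + j * (j + (n + 2))" for j by (simp add: algebra_simps)
      thus ?thesis unfolding durfee_sum_def
        by (subst fpsum_Suc[OF locfin_square]) (simp only: power_add mult.assoc, simp)
    qed
    hence "durfee_sum n = iq n + fps_X ^ Suc n * r"
      by (simp only: fpsum_cmult[OF locfin_square] r_def)
    \<comment> \<open>Independence of k permits the value n, for which the term j = 0 is 1/(q;q)_n
      and all others are divisible by q^(n+1).\<close>
    hence "durfee_sum k = iq n + fps_X ^ Suc n * r"
      using durfee_sum_const[of k] durfee_sum_const[of n] by metis
    hence "durfee_sum k * qpoch fps_X fps_X n = 1 + fps_X ^ Suc n * (r * qpoch fps_X fps_X n)"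
      by (simp only: distrib_right iq_mult_qpoch mult.assoc)
    thus "\<exists>r. durfee_sum k * qpoch fps_X fps_X n = 1 + fps_X ^ Suc n * (r :: 'a fps)" by blast
  qed
qed

section \<open>The truncated Durfee sum\<close>

definition trunc_sum :: "nat \<Rightarrow> nat \<Rightarrow> 'a::field_char_0 fps" where
  "trunc_sum k N = (\<Sum>j\<le>N. fps_X ^ j * (iq j * iq (j + k)))"

text \<open>The series t_k of the overview; \<open>trunc_sum k N\<close> is its inner sum.\<close>

definition hecke_coeff :: "nat \<Rightarrow> 'a::field_char_0 fps" where
  "hecke_coeff k = fpsum (\<lambda>N. fps_X ^ (N * (N + k)) * trunc_sum k N) UNIV"

text \<open>Brought to the form that the right-hand side of \<open>trunc_sum_telescope\<close> takes
  with 0 in place of \<open>Suc N\<close>, so that the term N = 0 joins the same sum in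
  \<open>hecke_coeff_rec\<close>.\<close>

lemma trunc_sum_0: "trunc_sum k 0 = (1 - fps_X ^ (k + 1)) * (iq 0 * iq (k + 1))"
  using iq_Suc[of k] by (simp add: trunc_sum_def)

text \<open>Passing from N to N + 1 adds one term to each truncated sum; together they make up the
  increment of the right-hand side.\<close>

lemma trunc_sum_telescope:
  "trunc_sum k (Suc N) - fps_X ^ (2 * k + 3) * trunc_sum (k + 2) N =
     (1 - fps_X ^ (k + 1)) * (iq (Suc N) * (iq (Suc N + k + 1) :: 'a::field_char_0 fps))"
proof -
  have step: "(1 - fps_X ^ (k + 1)) * (iq N * iq (N + k + 1)) + fps_X ^ Suc N * (iq (Suc N) * iq (Suc N + k))
          - fps_X ^ (2 * k + 3) * (fps_X ^ N * (iq N * iq (N + (k + 2)))) =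
        (1 - fps_X ^ (k + 1)) * (iq (Suc N) * (iq (Suc N + k + 1) :: 'a fps))" for N
  proof -
    \<comment> \<open>Up to the common factor u v, the claim is (1-x)(1-y)(1-xy) + y(1-xy) - x^2
      y(1-y) = 1 - x.\<close>
    define x y :: "'a fps" where "x = fps_X ^ (k + 1)" and "y = fps_X ^ Suc N"
    define u v :: "'a fps" where "u = iq (Suc N)" and "v = iq (Suc N + k + 1)"
    have "iq N = (1 - y) * u" using iq_Suc[of N] by (simp add: y_def u_def)
    moreover have "iq (N + k + 1) = (1 - x * y) * v" "iq (Suc N + k) = (1 - x * y) * v"
      "iq (N + (k + 2)) = v"
      using iq_Suc[of "Suc N + k"] by (simp_all add: x_def y_def v_def power_add mult_ac)
    moreover have "fps_X ^ (2 * k + 3) * (fps_X ^ N * w) = x * x * y * w" for w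
      by (simp add: x_def y_def power_add power_mult power2_eq_square power3_eq_cube mult_ac)
    ultimately show ?thesis
      by (simp only: x_def[symmetric] y_def[symmetric] u_def[symmetric] v_def[symmetric])
         (simp add: algebra_simps)
  qed
  show ?thesis
  proof (induction N)
    case 0
    have "trunc_sum k (Suc 0) - fps_X ^ (2 * k + 3) * trunc_sum (k + 2) 0 =
            (1 - fps_X ^ (k + 1)) * (iq 0 * iq (0 + k + 1)) + fps_X ^ Suc 0 * (iq (Suc 0) * iq (Suc 0 + k))
          - fps_X ^ (2 * k + 3) * (fps_X ^ 0 * (iq 0 * (iq (0 + (k + 2)) :: 'a fps)))"
      using trunc_sum_0[of k, where 'a = 'a] by (simp add: trunc_sum_def)
    thus ?case by (simp only: step)
  next
    case (Suc N)
    have "trunc_sum k (Suc (Suc N)) - fps_X ^ (2 * k + 3) * trunc_sum (k + 2) (Suc N) =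
            (trunc_sum k (Suc N) - fps_X ^ (2 * k + 3) * trunc_sum (k + 2) N)
            + fps_X ^ Suc (Suc N) * (iq (Suc (Suc N)) * iq (Suc (Suc N) + k))
            - fps_X ^ (2 * k + 3) * (fps_X ^ Suc N * (iq (Suc N) * (iq (Suc N + (k + 2)) :: 'a fps)))"
      by (simp add: trunc_sum_def ring_distribs)
    thus ?case by (simp only: Suc step)
  qed
qed

text \<open>The factor q^(3k+4) aligns term N of t_(k+2) with term N + 1 of t_k. The inner sums then
  telescope, and \<open>durfee_mixed\<close> evaluates the rest, leaving (1 - q^(k+1))(1 +
  q^(k+1)).\<close>

lemma hecke_coeff_rec:
  "hecke_coeff k = (1 - fps_X ^ (2 * k + 2)) * durfee_sum 0 +
     fps_X ^ (3 * k + 4) * (hecke_coeff (k + 2) :: 'a::field_char_0 fps)"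
proof -
  have l: "locfin (\<lambda>N. fps_X ^ (Suc N * (Suc N + k)) * F N) UNIV" for F :: "nat \<Rightarrow> 'a fps"
    by (rule locfin_power_nat[of _ 0]) simp
  have head: "fpsum (\<lambda>N. fps_X ^ (N * (N + k)) * G N) UNIV =
      G 0 + fpsum (\<lambda>N. fps_X ^ (Suc N * (Suc N + k)) * G (Suc N)) UNIV" for G :: "nat \<Rightarrow> 'a fps"
    by (subst fpsum_Suc[OF locfin_square]) simp
  have "fps_X ^ (3 * k + 4) * hecke_coeff (k + 2) =
          fpsum (\<lambda>N. fps_X ^ (Suc N * (Suc N + k)) * (fps_X ^ (2 * k + 3) * (trunc_sum (k + 2) N :: 'a fps))) UNIV"
    unfolding hecke_coeff_def
  proof (subst fpsum_cmult[OF locfin_square, symmetric], rule fpsum_cong)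
    fix N
    have "3 * k + 4 + N * (N + (k + 2)) = Suc N * (Suc N + k) + (2 * k + 3)"
      by (simp add: algebra_simps)
    thus "fps_X ^ (3 * k + 4) * (fps_X ^ (N * (N + (k + 2))) * trunc_sum (k + 2) N) =
            fps_X ^ (Suc N * (Suc N + k)) * (fps_X ^ (2 * k + 3) * (trunc_sum (k + 2) N :: 'a fps))"
      by (simp only: power_add[symmetric] mult.assoc[symmetric])
  qed
  moreover have "hecke_coeff k = trunc_sum k 0 +
                   fpsum (\<lambda>N. fps_X ^ (Suc N * (Suc N + k)) * (trunc_sum k (Suc N) :: 'a fps)) UNIV"
    unfolding hecke_coeff_def by (rule head)
  ultimately have "hecke_coeff k - fps_X ^ (3 * k + 4) * hecke_coeff (k + 2) = trunc_sum k 0 +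
      fpsum (\<lambda>N. fps_X ^ (Suc N * (Suc N + k)) *
        (trunc_sum k (Suc N) - fps_X ^ (2 * k + 3) * (trunc_sum (k + 2) N :: 'a fps))) UNIV"
    by (simp only: right_diff_distrib fpsum_minus[OF l l] add_diff_eq)
  also have "\<dots> = fpsum (\<lambda>N. fps_X ^ (N * (N + k)) * ((1 - fps_X ^ (k + 1)) * (iq N * iq (N + k + 1)))) UNIV"
    by (simp only: head trunc_sum_telescope trunc_sum_0 add_0)
  also have "\<dots> = (1 - fps_X ^ (k + 1)) * fpsum (\<lambda>N. fps_X ^ (N * (N + k)) * (iq N * iq (N + k + 1))) UNIV"
    by (subst fpsum_cmult[OF locfin_square, symmetric]) (simp only: mult.left_commute)
  also have "\<dots> = (1 - fps_X ^ (k + 1)) * (durfee_sum 0 + fps_X ^ (k + 1) * durfee_sum 0)"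
    by (simp only: durfee_mixed durfee_sum_const[of "k + 1"] durfee_sum_const[of "k + 2"])
  also have "\<dots> = (1 - fps_X ^ (2 * k + 2)) * durfee_sum 0"
    by (simp add: algebra_simps flip: power_add mult_2)
  finally show ?thesis by (simp add: algebra_simps)
qed

text \<open>Obtained by iterating the recursion for (q;q)_inf t_k: the factors q^(3(k+2i)+4) with i
  < r multiply to q^(r(3r+1+3k)), and a further q^(2(k+2r)+2) gives the negative term.\<close>

definition false_theta :: "nat \<Rightarrow> 'a::field_char_0 fps" where
  "false_theta k =
     fpsum (\<lambda>r. fps_X ^ (r * (3 * r + 1 + 3 * k)) - fps_X ^ ((3 * r + 2) * (r + 1 + k))) UNIV"

lemma locfin_false_theta:
  "locfin (\<lambda>r. fps_X ^ (r * (3 * r + 1 + 3 * k)) - fps_X ^ ((3 * r + 2) * (r + 1 + k)) :: 'a::field_char_0 fps) UNIV"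
proof -
  have "locfin (\<lambda>r. fps_X ^ (r + r * (3 * r + 3 * k)) * (1 - fps_X ^ (2 + 4 * r + 2 * k)) :: 'a fps) UNIV"
    by (rule locfin_power_nat[of _ 0]) simp
  thus ?thesis by (simp add: algebra_simps flip: power_add)
qed

lemma false_theta_rec:
  "false_theta k = 1 - fps_X ^ (2 * k + 2) + fps_X ^ (3 * k + 4) * (false_theta (k + 2) :: 'a::field_char_0 fps)"
proof -
  have e: "Suc r * (3 * Suc r + 1 + 3 * k) = (3 * k + 4) + r * (3 * r + 1 + 3 * (k + 2))"
    "(3 * Suc r + 2) * (Suc r + 1 + k) = (3 * k + 4) + (3 * r + 2) * (r + 1 + (k + 2))" for r
    by (simp_all add: algebra_simps)
  show ?thesis
    unfolding false_theta_def
    by (subst fpsum_Suc[OF locfin_false_theta], subst fpsum_cmult[OF locfin_false_theta, symmetric])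
       (simp only: e power_add[of _ "3 * k + 4"] right_diff_distrib, simp add: algebra_simps)
qed

text \<open>Both sides obey \<open>false_theta_rec\<close>, since (q;q)_inf times the Durfee sum is
  1; \<open>fps_recursion_zero\<close> disposes of their difference.\<close>

lemma hecke_coeff_eq: "hecke_coeff k * qpoch_inf fps_X fps_X = (false_theta k :: 'a::field_char_0 fps)"
proof -
  define d :: "nat \<Rightarrow> 'a fps" where "d k = hecke_coeff k * qpoch_inf fps_X fps_X - false_theta k" for k
  have "d k = fps_X * fps_X ^ (3 * k + 3) * d (k + 2)" for k
  proof -
    have "hecke_coeff k * qpoch_inf fps_X fps_X = (1 - fps_X ^ (2 * k + 2)) * (durfee_sum 0 * qpoch_inf fps_X fps_X) +
            fps_X ^ (3 * k + 4) * (hecke_coeff (k + 2) * qpoch_inf fps_X fps_X :: 'a fps)"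
      by (subst hecke_coeff_rec) (simp add: ring_distribs mult.assoc)
    moreover have "fps_X ^ (3 * k + 4) = fps_X * (fps_X ^ (3 * k + 3) :: 'a fps)"
      by (simp flip: power_Suc)
    ultimately show ?thesis
      using false_theta_rec[of k, where 'a = 'a] unfolding d_def durfee_sum_eq
      by (simp only: right_diff_distrib) simp
  qed
  hence "d k = 0" by (intro fps_recursion_zero) blast
  thus ?thesis by (simp add: d_def)
qed

section \<open>Products of Euler sums\<close>

text \<open>Pairs are parametrised by their smaller entry j and their difference. The diagonal
  belongs to the first sum only, hence \<open>Suc k\<close> in the second.\<close>

lemma fpsum_nat_pairs:
  fixes F :: "nat \<times> nat \<Rightarrow> 'a::comm_ring_1 fps"
  assumes "locfin F UNIV"
  shows   "fpsum F UNIV = fpsum (\<lambda>(k, j). F (j, j + k)) UNIV + fpsum (\<lambda>(k, j). F (j + Suc k, j)) UNIV"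
proof -
  define A B :: "(nat \<times> nat) set" where "A = {(a, b). a \<le> b}" and "B = {(a, b). b < a}"
  have U: "A \<union> B = UNIV" "A \<inter> B = {}" by (auto simp: A_def B_def)
  have "bij_betw (\<lambda>(k, j). (j, j + k)) UNIV A"
    by (rule bij_betw_byWitness[where f' = "\<lambda>(a, b). (b - a, a)"]) (auto simp: A_def)
  hence A: "fpsum F A = fpsum (\<lambda>(k, j). F (j, j + k)) UNIV"
    by (simp add: fpsum_reindex case_prod_unfold)
  have "bij_betw (\<lambda>(k, j). (j + Suc k, j)) UNIV B"
    by (rule bij_betw_byWitness[where f' = "\<lambda>(a, b). (a - b - 1, b)"]) (auto simp: B_def)
  hence B: "fpsum F B = fpsum (\<lambda>(k, j). F (j + Suc k, j)) UNIV"
    by (simp add: fpsum_reindex case_prod_unfold)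
  show ?thesis
    using fpsum_Un_disjoint[of F A B] assms by (simp add: U A B)
qed

lemma locfin_power_pairs:
  fixes e :: "nat \<times> nat \<Rightarrow> nat"
  assumes "\<And>i j. i \<le> e (i, j)" "\<And>i j. j \<le> e (i, j)"
  shows   "locfin (\<lambda>p. fps_X ^ e p * c p) A"
proof (rule locfin_power)
  fix k
  have "{p \<in> A. e p \<le> k} \<subseteq> {..k} \<times> {..k}"
  proof safe
    fix i j assume "e (i, j) \<le> k"
    thus "i \<le> k" "j \<le> k" using assms(1)[of i j] assms(2)[of j i] by auto
  qed
  thus "finite {p \<in> A. e p \<le> k}" by (rule finite_subset) auto
qed

lemma fpsum_pairs:
  assumes "locfin (\<lambda>(i, j). F i j) UNIV"
  shows   "fpsum (\<lambda>(i, j). F i j) UNIV = fpsum (\<lambda>i. fpsum (F i) UNIV) UNIV"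
  using fpsum_Sigma(1)[of F UNIV "\<lambda>_. UNIV"] assms by simp

lemma fpsum_swap:
  assumes "locfin (\<lambda>(i, j). F i j) UNIV"
  shows   "fpsum (\<lambda>i. fpsum (F i) UNIV) UNIV = fpsum (\<lambda>j. fpsum (\<lambda>i. F i j) UNIV) UNIV"
proof -
  have b: "bij_betw prod.swap UNIV UNIV" by simp
  have "locfin (\<lambda>(j, i). F i j) UNIV"
    using locfin_reindex[OF b assms] by (simp add: case_prod_unfold)
  from fpsum_pairs[OF this] fpsum_pairs[OF assms] fpsum_reindex[OF b, of "\<lambda>(i, j). F i j"]
  show ?thesis by (simp add: case_prod_unfold)
qed

text \<open>The sum over the smaller of two Euler indices at fixed difference k; \<open>c\<close>
  collects the shifts of both Euler sums.\<close>

definition rank_sum :: "nat \<Rightarrow> nat \<Rightarrow> 'a::field_char_0 fps" where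
  "rank_sum c k = fpsum (\<lambda>j. fps_X ^ (j * (j + (k + c))) * (iq j * iq (j + k))) UNIV"

lemma rank_sum_0: "rank_sum 0 k = durfee_sum k"
  by (simp add: rank_sum_def durfee_sum_def)

text \<open>Terms are sorted by the difference of the indices. The extra unit in
  \<open>Suc d\<close> turns 2 (j choose 2) into j^2 and, in the first sum,
  \<open>k choose 2\<close> into \<open>Suc k choose 2\<close>.\<close>

lemma euler_sum_mult:
  "euler_sum c * euler_sum (Suc d) =
     fpsum (\<lambda>k. fps_X ^ ((Suc k choose 2) + d * k) * rank_sum (c + d) k) UNIV +
     fpsum (\<lambda>k. fps_X ^ ((Suc k choose 2) + c * Suc k) * (rank_sum (c + d) (Suc k) :: 'a::field_char_0 fps)) UNIV"
proof -
  define F :: "nat \<times> nat \<Rightarrow> 'a fps" where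
    "F = (\<lambda>(a, b). (fps_X ^ ((a choose 2) + c * a) * iq a) * (fps_X ^ ((b choose 2) + Suc d * b) * iq b))"
  have F: "locfin F UNIV"
    using locfin_mult[OF locfin_euler locfin_euler] by (simp add: F_def)
  have "euler_sum c * euler_sum (Suc d) = fpsum F UNIV"
    unfolding euler_sum_def by (subst fpsum_mult[OF locfin_euler locfin_euler]) (simp add: F_def)
  also have "\<dots> = fpsum (\<lambda>(k, j). F (j, j + k)) UNIV + fpsum (\<lambda>(k, j). F (j + Suc k, j)) UNIV"
    by (rule fpsum_nat_pairs[OF F])
  also have "(\<lambda>(k, j). F (j, j + k)) = (\<lambda>(k, j). fps_X ^ ((Suc k choose 2) + d * k) *
               (fps_X ^ (j * (j + (k + (c + d)))) * (iq j * iq (j + k))))"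
  proof (intro ext, clarify)
    fix k j
    have "((j choose 2) + c * j) + ((j + k choose 2) + Suc d * (j + k)) =
            ((Suc k choose 2) + d * k) + j * (j + (k + (c + d)))"
      using double_choose_two_Suc[of j] by (simp add: choose_two_add choose_two_Suc algebra_simps)
    thus "F (j, j + k) = fps_X ^ ((Suc k choose 2) + d * k) *
            (fps_X ^ (j * (j + (k + (c + d)))) * (iq j * iq (j + k)))"
      unfolding F_def by (simp add: mult_ac flip: power_add mult.assoc)
  qed
  also have "(\<lambda>(k, j). F (j + Suc k, j)) = (\<lambda>(k, j). fps_X ^ ((Suc k choose 2) + c * Suc k) *
               (fps_X ^ (j * (j + (Suc k + (c + d)))) * (iq j * iq (j + Suc k))))"
  proof (intro ext, clarify)
    fix k j
    have "((j + Suc k choose 2) + c * (j + Suc k)) + ((j choose 2) + Suc d * j) =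
            ((Suc k choose 2) + c * Suc k) + j * (j + (Suc k + (c + d)))"
      using double_choose_two_Suc[of j] by (simp only: choose_two_add) (simp add: choose_two_Suc algebra_simps)
    thus "F (j + Suc k, j) = fps_X ^ ((Suc k choose 2) + c * Suc k) *
            (fps_X ^ (j * (j + (Suc k + (c + d)))) * (iq j * iq (j + Suc k)))"
      unfolding F_def by (simp add: mult_ac flip: power_add mult.assoc)
  qed
  also have "fpsum (\<lambda>(k, j). fps_X ^ ((Suc k choose 2) + d * k) *
               (fps_X ^ (j * (j + (k + (c + d)))) * (iq j * iq (j + k)))) UNIV =
             fpsum (\<lambda>k. fps_X ^ ((Suc k choose 2) + d * k) * (rank_sum (c + d) k :: 'a fps)) UNIV"
  proof (subst fpsum_pairs)
    have "locfin (\<lambda>p. fps_X ^ (case p of (k, j) \<Rightarrow> (Suc k choose 2) + d * k + j * (j + (k + (c + d)))) *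
            (case p of (k, j) \<Rightarrow> (iq j * iq (j + k) :: 'a fps))) UNIV"
      by (rule locfin_power_pairs)
         (auto intro: trans_le_add1 trans_le_add2 choose_two_Suc_ge le_square[THEN order.trans])
    thus "locfin (\<lambda>(k, j). fps_X ^ ((Suc k choose 2) + d * k) *
               (fps_X ^ (j * (j + (k + (c + d)))) * (iq j * iq (j + k)) :: 'a fps)) UNIV"
      by (simp add: case_prod_unfold power_add mult.assoc)
  qed (simp only: fpsum_cmult[OF locfin_square] rank_sum_def)
  also have "fpsum (\<lambda>(k, j). fps_X ^ ((Suc k choose 2) + c * Suc k) *
               (fps_X ^ (j * (j + (Suc k + (c + d)))) * (iq j * iq (j + Suc k)))) UNIV =
             fpsum (\<lambda>k. fps_X ^ ((Suc k choose 2) + c * Suc k) * (rank_sum (c + d) (Suc k) :: 'a fps)) UNIV"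
  proof (subst fpsum_pairs)
    have "locfin (\<lambda>p. fps_X ^ (case p of (k, j) \<Rightarrow> (Suc k choose 2) + c * Suc k + j * (j + (Suc k + (c + d)))) *
            (case p of (k, j) \<Rightarrow> (iq j * iq (j + Suc k) :: 'a fps))) UNIV"
      by (rule locfin_power_pairs)
         (auto intro: trans_le_add1 trans_le_add2 choose_two_Suc_ge le_square[THEN order.trans])
    thus "locfin (\<lambda>(k, j). fps_X ^ ((Suc k choose 2) + c * Suc k) *
               (fps_X ^ (j * (j + (Suc k + (c + d)))) * (iq j * iq (j + Suc k)) :: 'a fps)) UNIV"
      by (simp add: case_prod_unfold power_add mult.assoc)
  qed (simp only: fpsum_cmult[OF locfin_square] rank_sum_def)
  finally show ?thesis .
qed

lemma locfin_triangular: "locfin (\<lambda>k. fps_X ^ (Suc k choose 2) * F k) UNIV"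
  by (rule locfin_power_nat[of _ 0]) (simp add: choose_two_Suc)

text \<open>At c = d = 0 every inner sum is 1/(q;q)_inf, so both halves of
  \<open>euler_sum_mult\<close> become the same triangular series.\<close>

lemma gauss_triangular:
  "fpsum (\<lambda>k. fps_X ^ (Suc k choose 2)) UNIV = (euler_sum 1)\<^sup>2 * (qpoch_inf fps_X fps_X :: 'a::field_char_0 fps)"
proof -
  let ?psi = "fpsum (\<lambda>k. fps_X ^ (Suc k choose 2)) UNIV :: 'a fps"
  have "fpsum (\<lambda>k. fps_X ^ (Suc k choose 2) * durfee_sum 0) UNIV = ?psi * durfee_sum 0"
    using fpsum_cmult[OF locfin_triangular[of "\<lambda>_. 1"], of "durfee_sum 0"]
    by (simp add: mult.commute)
  moreover have "rank_sum 0 k = (durfee_sum 0 :: 'a fps)" for k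
    unfolding rank_sum_0 by (rule durfee_sum_const)
  ultimately have "euler_sum 0 * euler_sum (Suc 0) = ?psi * durfee_sum 0 + ?psi * durfee_sum 0"
    unfolding euler_sum_mult by simp
  \<comment> \<open>\<open>euler_sum 0\<close> is twice \<open>euler_sum 1\<close>, and
    characteristic 0 permits cancelling the 2.\<close>
  hence "2 * (euler_sum 1)\<^sup>2 = 2 * (?psi * durfee_sum 0)"
    by (subst (asm) euler_sum_rec) (simp add: power2_eq_square mult.assoc)
  hence "(euler_sum 1)\<^sup>2 = ?psi * durfee_sum 0" by simp
  thus ?thesis by (simp add: mult.assoc durfee_sum_eq)
qed

text \<open>Substitute N = n + j, where (n+j)(n+j+k) + j = n^2 + nk + j(j+k+2n+1). The index
  \<open>Suc n + n\<close> is the shift that the square of \<open>euler_sum (Suc n)\<close> produces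
  in \<open>euler_sum_mult\<close>.\<close>

lemma hecke_coeff_pairs:
  "fpsum (\<lambda>n. fps_X ^ (n\<^sup>2 + n * k) * rank_sum (Suc n + n) k) UNIV = (hecke_coeff k :: 'a::field_char_0 fps)"
proof -
  define G :: "nat \<times> nat \<Rightarrow> 'a fps" where
    "G = (\<lambda>(N, j). fps_X ^ (N * (N + k)) * (fps_X ^ j * (iq j * iq (j + k))))"
  have G: "locfin G (SIGMA N:UNIV. {..N})"
    unfolding locfin_def
  proof
    fix l
    have "{p \<in> SIGMA N:UNIV. {..N}. fps_nth (G p) l \<noteq> 0} \<subseteq> {..l} \<times> {..l}"
    proof safe
      fix N j assume *: "fps_nth (G (N, j)) l \<noteq> 0" "j \<le> N"
      hence "N * (N + k) \<le> l" by (auto simp: G_def fps_X_power_mult_nth split: if_splits)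
      moreover have "N \<le> N * (N + k)" by (cases N) auto
      ultimately have "N \<le> l" by (rule order.trans[rotated])
      thus "N \<le> l" "j \<le> l" using * by auto
    qed
    thus "finite {p \<in> SIGMA N:UNIV. {..N}. fps_nth (G p) l \<noteq> 0}" by (rule finite_subset) auto
  qed
  have b: "bij_betw (\<lambda>(n, j). (n + j, j)) UNIV (SIGMA N:UNIV. {..N :: nat})"
    by (rule bij_betw_byWitness[where f' = "\<lambda>(N, j). (N - j, j)"]) auto
  have eq: "(\<lambda>p. G (case p of (n, j) \<Rightarrow> (n + j, j))) =
          (\<lambda>(n, j). fps_X ^ (n\<^sup>2 + n * k) * (fps_X ^ (j * (j + (k + (Suc n + n)))) * (iq j * iq (j + k))))"
  proof (intro ext, clarify)
    fix n j
    have "(n + j) * ((n + j) + k) + j = n\<^sup>2 + n * k + j * (j + (k + (Suc n + n)))"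
      by (simp add: algebra_simps power2_eq_square)
    hence "fps_X ^ ((n + j) * ((n + j) + k)) * fps_X ^ j =
             (fps_X ^ (n\<^sup>2 + n * k) * fps_X ^ (j * (j + (k + (Suc n + n)))) :: 'a fps)"
      by (simp only: power_add[symmetric])
    thus "G (n + j, j) = fps_X ^ (n\<^sup>2 + n * k) * (fps_X ^ (j * (j + (k + (Suc n + n)))) * (iq j * iq (j + k)))"
      unfolding G_def by (simp only: mult.assoc[symmetric] prod.case)
  qed
  have "hecke_coeff k = fpsum (\<lambda>N. fpsum (\<lambda>j. G (N, j)) {..N}) UNIV"
    unfolding hecke_coeff_def
    by (rule fpsum_cong) (simp add: fpsum_finite trunc_sum_def sum_distrib_left G_def)
  also have "\<dots> = fpsum G (SIGMA N:UNIV. {..N})"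
    using fpsum_Sigma(1)[of "\<lambda>N j. G (N, j)" UNIV "\<lambda>N. {..N}"] G by simp
  also have "\<dots> = fpsum (\<lambda>p. G (case p of (n, j) \<Rightarrow> (n + j, j))) UNIV"
    by (rule fpsum_reindex[OF b])
  also have "\<dots> = fpsum (\<lambda>n. fpsum (\<lambda>j. fps_X ^ (n\<^sup>2 + n * k) *
                    (fps_X ^ (j * (j + (k + (Suc n + n)))) * (iq j * iq (j + k)))) UNIV) UNIV"
    using locfin_reindex[OF b G] unfolding eq by (rule fpsum_pairs)
  also have "\<dots> = fpsum (\<lambda>n. fps_X ^ (n\<^sup>2 + n * k) * rank_sum (Suc n + n) k) UNIV"
    by (simp only: fpsum_cmult[OF locfin_square] rank_sum_def)
  finally show ?thesis ..
qed

lemma euler_sum_mock_theta: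
  "(euler_sum 1)\<^sup>2 * mock_theta_f =
     fpsum (\<lambda>k. fps_X ^ (Suc k choose 2) * hecke_coeff k) UNIV +
     fpsum (\<lambda>k. fps_X ^ (Suc (Suc k) choose 2) * (hecke_coeff (Suc k) :: 'a::field_char_0 fps)) UNIV"
proof -
  have sq: "n \<le> n\<^sup>2 + m" for n m :: nat by (cases n) (auto simp: power2_eq_square)
  have l: "locfin (\<lambda>n. fps_X ^ (n\<^sup>2) * F n) UNIV" for F :: "nat \<Rightarrow> 'a fps"
    by (rule locfin_power_nat[of _ 0]) (use sq[of _ 0] in simp)
  define c :: "nat \<Rightarrow> 'a fps" where "c n = inverse ((qpoch (- fps_X) fps_X n)\<^sup>2)" for n
  have c: "(euler_sum 1)\<^sup>2 * c n = euler_sum (Suc n) * euler_sum (Suc n)" for n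
  proof -
    have "(qpoch (- fps_X) fps_X n)\<^sup>2 * c n = 1"
      unfolding c_def by (rule inverse_mult_eq_1') (simp add: power2_eq_square qpoch_neg_nth_0)
    thus ?thesis
      by (subst euler_sum_1_eq[of n]) (simp add: power_mult_distrib power2_eq_square mult_ac)
  qed
  \<comment> \<open>The value of \<open>s\<close> is 0 for nonnegative and 1 for negative
    differences of the Euler indices, with absolute value s + k.\<close>
  define R :: "nat \<Rightarrow> nat \<Rightarrow> nat \<Rightarrow> 'a fps" where
    "R s n k = fps_X ^ (Suc (s + k) choose 2) * (fps_X ^ (n\<^sup>2 + n * (s + k)) * rank_sum (Suc n + n) (s + k))" for s n k
  have R: "locfin (\<lambda>(n, k). R s n k) UNIV" for s
  proof -
    have "locfin (\<lambda>p. fps_X ^ (case p of (n, k) \<Rightarrow> (Suc (s + k) choose 2) + (n\<^sup>2 + n * (s + k))) *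
            (case p of (n, k) \<Rightarrow> (rank_sum (Suc n + n) (s + k) :: 'a fps))) UNIV"
      by (rule locfin_power_pairs)
         (auto intro: trans_le_add2 sq trans_le_add1[OF order.trans[OF _ choose_two_Suc_ge]])
    thus ?thesis unfolding R_def by (simp add: case_prod_unfold power_add mult.assoc)
  qed
  have R_sum: "fpsum (\<lambda>n. fpsum (R s n) UNIV) UNIV =
                 fpsum (\<lambda>k. fps_X ^ (Suc (s + k) choose 2) * hecke_coeff (s + k)) UNIV" for s
  proof -
    have "locfin (\<lambda>n. fps_X ^ (n\<^sup>2 + n * (s + k)) * rank_sum (Suc n + n) (s + k) :: 'a fps) UNIV" for k
      by (rule locfin_power_nat[of _ 0]) (use sq in simp)
    thus ?thesis
      by (subst fpsum_swap[OF R]) (simp only: R_def fpsum_cmult hecke_coeff_pairs)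
  qed
  have eq: "fps_X ^ (n\<^sup>2) * (euler_sum (Suc n) * euler_sum (Suc n)) = fpsum (R 0 n) UNIV + fpsum (R 1 n) UNIV" for n
  proof -
    have t: "locfin (\<lambda>k. fps_X ^ ((Suc k choose 2) + e k) * F k) UNIV" for e and F :: "nat \<Rightarrow> 'a fps"
      by (rule locfin_power_nat[of _ 0]) (simp add: choose_two_Suc)
    have "fps_X ^ (n\<^sup>2) * fpsum (\<lambda>k. fps_X ^ ((Suc k choose 2) + n * k) * rank_sum (Suc n + n) k) UNIV = fpsum (R 0 n) UNIV"
      by (subst fpsum_cmult[OF t, symmetric], rule fpsum_cong) (simp add: R_def power_add mult_ac)
    \<comment> \<open>The surplus \<open>Suc k\<close> in \<open>Suc n * Suc k\<close> raises
      \<open>Suc k choose 2\<close> to the next triangular number.\<close>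
    moreover have "fps_X ^ (n\<^sup>2) * fpsum (\<lambda>k. fps_X ^ ((Suc k choose 2) + Suc n * Suc k) *
        rank_sum (Suc n + n) (Suc k)) UNIV = fpsum (R 1 n) UNIV"
      by (subst fpsum_cmult[OF t, symmetric], rule fpsum_cong)
         (simp add: R_def choose_two_Suc[of "Suc _"] power_add mult_ac)
    ultimately show ?thesis unfolding euler_sum_mult by (simp only: distrib_left)
  qed
  have "fps_nth ((qpoch (- fps_X) fps_X n)\<^sup>2 :: 'a fps) 0 \<noteq> 0" for n
    by (simp add: power2_eq_square qpoch_neg_nth_0)
  hence f: "mock_theta_f = (\<Sum>n. fps_X ^ (n\<^sup>2) * c n)"
    unfolding mock_theta_f_def c_def by (simp add: fps_divide_unit)
  have "(euler_sum 1)\<^sup>2 * mock_theta_f = fpsum (\<lambda>n. (euler_sum 1)\<^sup>2 * (fps_X ^ (n\<^sup>2) * c n)) UNIV"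
    unfolding f suminf_eq_fpsum[OF l] by (rule fpsum_cmult[OF l, symmetric])
  also have "\<dots> = fpsum (\<lambda>n. fpsum (R 0 n) UNIV + fpsum (R 1 n) UNIV) UNIV"
    by (simp only: mult.left_commute[of "(euler_sum 1)\<^sup>2"] c eq)
  also have "\<dots> = fpsum (\<lambda>n. fpsum (R 0 n) UNIV) UNIV + fpsum (\<lambda>n. fpsum (R 1 n) UNIV) UNIV"
    using fpsum_Sigma(2)[of "R _" UNIV "\<lambda>_. UNIV"] R by (intro fpsum_add) auto
  finally show ?thesis by (simp add: R_sum)
qed

section \<open>The Hecke-type double sum\<close>

lemma hecke_exp_eqI:
  assumes "(int n ^ 2 - 3 * m ^ 2) + (int n - m) = 2 * int e"
  shows   "hecke_exp n m = e"
  using assms by (simp add: hecke_exp_def)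

text \<open>Separates positive from negative terms; s = 0 and s = 1 together give four double sums,
  one for each sector of the Hecke sum.\<close>

lemma fpsum_false_theta:
  "fpsum (\<lambda>k. fps_X ^ (Suc (s + k) choose 2) * false_theta (s + k)) UNIV =
   fpsum (\<lambda>(k, r). fps_X ^ ((Suc (s + k) choose 2) + r * (3 * r + 1 + 3 * (s + k)))) UNIV -
   fpsum (\<lambda>(k, r). fps_X ^ ((Suc (s + k) choose 2) + (3 * r + 2) * (r + 1 + (s + k))) :: 'a::field_char_0 fps) UNIV"
proof -
  define P Q :: "nat \<times> nat \<Rightarrow> 'a fps" where
    "P = (\<lambda>(k, r). fps_X ^ ((Suc (s + k) choose 2) + r * (3 * r + 1 + 3 * (s + k))))" and
    "Q = (\<lambda>(k, r). fps_X ^ ((Suc (s + k) choose 2) + (3 * r + 2) * (r + 1 + (s + k))))"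
  have le: "i \<le> Suc (s + i) choose 2" "j \<le> j * (3 * j + 1 + 3 * (s + i))" "j \<le> (3 * j + 2) * (j + 1 + (s + i))" for i j
    using choose_two_Suc_ge[of "s + i"] by (auto simp: algebra_simps)
  have "locfin (\<lambda>p. fps_X ^ (case p of (k, r) \<Rightarrow> (Suc (s + k) choose 2) + r * (3 * r + 1 + 3 * (s + k))) * (1 :: 'a fps)) UNIV"
       "locfin (\<lambda>p. fps_X ^ (case p of (k, r) \<Rightarrow> (Suc (s + k) choose 2) + (3 * r + 2) * (r + 1 + (s + k))) * (1 :: 'a fps)) UNIV"
    by ((rule locfin_power_pairs; unfold prod.case), (rule trans_le_add1 trans_le_add2, rule le)+)+
  hence l: "locfin P UNIV" "locfin Q UNIV"
    by (simp_all add: P_def Q_def case_prod_unfold)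
  hence "locfin (\<lambda>p. P p + (-1) * Q p) UNIV"
    unfolding locfin_def
    using finite_subset[of "{p. fps_nth (P p + (-1) * Q p) k \<noteq> 0}"
       "{p. fps_nth (P p) k \<noteq> 0} \<union> {p. fps_nth (Q p) k \<noteq> 0}" for k] by force
  hence "locfin (\<lambda>(k, r). P (k, r) - Q (k, r)) UNIV" by (simp add: case_prod_unfold)
  hence "fpsum (\<lambda>(k, r). P (k, r) - Q (k, r)) UNIV = fpsum (\<lambda>k. fpsum (\<lambda>r. P (k, r) - Q (k, r)) UNIV) UNIV"
    by (rule fpsum_pairs)
  also have "\<dots> = fpsum (\<lambda>k. fps_X ^ (Suc (s + k) choose 2) * false_theta (s + k)) UNIV"
    unfolding false_theta_def fpsum_cmult[OF locfin_false_theta, symmetric]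
    by (intro fpsum_cong) (simp add: P_def Q_def power_add right_diff_distrib)
  finally show ?thesis
    using fpsum_minus[OF l] by (simp add: P_def Q_def case_prod_unfold)
qed

text \<open>
  The summands with $n \ge 3m \ge 0$ or $n + 1 \ge -3m > 0$ and the remaining ones are exchanged by the
  reflection $(n, m) \mapsto (2n - 3m, n - 2m)$, an automorph of $(n + \frac12)^2 - 3 (m + \frac16)^2$;
  on each half, $k$ measures the distance to the fixed line of the reflection.
\<close>

lemma hecke_sum_eq:
  "(\<Sum>n. \<Sum>m = - int (n div 2)..int (n div 2). of_int (sgn1 m) * fps_X ^ hecke_exp n m) =
     fpsum (\<lambda>k. fps_X ^ (Suc k choose 2) * false_theta k) UNIV +
     fpsum (\<lambda>k. fps_X ^ (Suc (Suc k) choose 2) * (false_theta (Suc k) :: 'a::field_char_0 fps)) UNIV"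
proof -
  define H where "H = (SIGMA n:UNIV. {- int (n div 2)..int (n div 2)})"
  define F :: "nat \<times> int \<Rightarrow> 'a fps" where "F = (\<lambda>(n, m). of_int (sgn1 m) * fps_X ^ hecke_exp n m)"
  define A B C D where "A = {(n, m) \<in> H. m \<ge> 0 \<and> 3 * m \<le> int n}"
    and "B = {(n, m) \<in> H. m \<ge> 0 \<and> 3 * m > int n}"
    and "C = {(n, m) \<in> H. m < 0 \<and> - 3 * m \<le> int n + 1}"
    and "D = {(n, m) \<in> H. m < 0 \<and> - 3 * m > int n + 1}"
  have F: "locfin F H"
    unfolding locfin_def
  proof
    fix k
    \<comment> \<open>\<open>hecke_exp_ge\<close> gives n div 4 \<le> k, that is, n \<le> 4k +
      3.\<close>
    have "{p \<in> H. fps_nth (F p) k \<noteq> 0} \<subseteq> (SIGMA n:{..4 * k + 3}. {- int (n div 2)..int (n div 2)})"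
    proof
      fix p assume p: "p \<in> {p \<in> H. fps_nth (F p) k \<noteq> 0}"
      obtain n m where nm: "p = (n, m)" by (cases p)
      with p have *: "(n, m) \<in> H" "fps_nth (F (n, m)) k \<noteq> 0" by simp_all
      have m: "m \<in> {- int (n div 2)..int (n div 2)}" using * by (simp add: H_def)
      have "hecke_exp n m = k" using * by (auto simp: F_def sgn1_def split: if_splits)
      with hecke_exp_ge[OF m] m show "p \<in> (SIGMA n:{..4 * k + 3}. {- int (n div 2)..int (n div 2)})"
        unfolding nm by auto
    qed
    thus "finite {p \<in> H. fps_nth (F p) k \<noteq> 0}" by (rule finite_subset) auto
  qed
  have "bij_betw (\<lambda>(k, r). (k + 3 * r, int r)) UNIV A"
    by (rule bij_betw_byWitness[where f' = "\<lambda>(n, m). (nat (int n - 3 * m), nat m)"])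
       (auto simp: A_def H_def)
  moreover have "hecke_exp (k + 3 * r) (int r) = (Suc (0 + k) choose 2) + r * (3 * r + 1 + 3 * (0 + k))" for k r
    using arg_cong[OF double_choose_two_Suc[of k], of int]
    by (intro hecke_exp_eqI) (simp add: algebra_simps power2_eq_square)
  ultimately have A: "fpsum F A =
      fpsum (\<lambda>(k, r). fps_X ^ ((Suc (0 + k) choose 2) + r * (3 * r + 1 + 3 * (0 + k)))) UNIV"
    by (simp add: fpsum_reindex F_def sgn1_def case_prod_unfold)
  \<comment> \<open>The reflection carries this point to the point of \<open>A\<close> with
    parameters k + 1 and r. The points of \<open>A\<close> with k = 0 are fixed and have no partner
    in \<open>B\<close>, whence \<open>1 + k\<close> in the exponents.\<close>
  have "bij_betw (\<lambda>(k, r). (2 * k + 2 + 3 * r, int (k + 1 + r))) UNIV B"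
    by (rule bij_betw_byWitness[where f' = "\<lambda>(n, m). (nat (3 * m - int n - 1), nat (int n - 2 * m))"])
       (auto simp: B_def H_def)
  moreover have "hecke_exp (2 * k + 2 + 3 * r) (int (k + 1 + r)) =
      (Suc (1 + k) choose 2) + r * (3 * r + 1 + 3 * (1 + k))" for k r
    using arg_cong[OF double_choose_two_Suc[of "1 + k"], of int]
    by (intro hecke_exp_eqI) (simp add: algebra_simps power2_eq_square)
  ultimately have B: "fpsum F B =
      fpsum (\<lambda>(k, r). fps_X ^ ((Suc (1 + k) choose 2) + r * (3 * r + 1 + 3 * (1 + k)))) UNIV"
    by (simp add: fpsum_reindex F_def sgn1_def case_prod_unfold)
  have neg: "fpsum (\<lambda>p. - G p) UNIV = - fpsum G UNIV" for G :: "nat \<times> nat \<Rightarrow> 'a fps"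
    by (rule fps_ext) (simp add: fpsum_nth_support sum_negf)
  have "bij_betw (\<lambda>(k, r). (k + 3 * r + 2, - int (r + 1))) UNIV C"
    by (rule bij_betw_byWitness[where f' = "\<lambda>(n, m). (nat (int n + 1 + 3 * m), nat (- m - 1))"])
       (auto simp: C_def H_def)
  moreover have "hecke_exp (k + 3 * r + 2) (- int (r + 1)) =
      (Suc (0 + k) choose 2) + (3 * r + 2) * (r + 1 + (0 + k))" for k r
    using arg_cong[OF double_choose_two_Suc[of k], of int]
    by (intro hecke_exp_eqI) (simp add: algebra_simps power2_eq_square)
  ultimately have C: "fpsum F C =
      - fpsum (\<lambda>(k, r). fps_X ^ ((Suc (0 + k) choose 2) + (3 * r + 2) * (r + 1 + (0 + k)))) UNIV"
    by (simp add: fpsum_reindex F_def sgn1_def case_prod_unfold neg)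
  \<comment> \<open>For m < 0 the exchange takes the form (n, m) to (2n + 3m + 1, -n - 2m - 1),
    which preserves the same quadratic form. \<open>D\<close> at k goes to \<open>C\<close> at k +
    1; the fixed points n + 1 = -3m lie in \<open>C\<close>.\<close>
  have "bij_betw (\<lambda>(k, r). (2 * k + 3 * r + 4, - int (k + r + 2))) UNIV D"
    by (rule bij_betw_byWitness[where f' = "\<lambda>(n, m). (nat (- 3 * m - 2 - int n), nat (int n + 2 * m))"])
       (auto simp: D_def H_def)
  moreover have "hecke_exp (2 * k + 3 * r + 4) (- int (k + r + 2)) =
      (Suc (1 + k) choose 2) + (3 * r + 2) * (r + 1 + (1 + k))" for k r
    using arg_cong[OF double_choose_two_Suc[of "1 + k"], of int]
    by (intro hecke_exp_eqI) (simp add: algebra_simps power2_eq_square)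
  ultimately have D: "fpsum F D =
      - fpsum (\<lambda>(k, r). fps_X ^ ((Suc (1 + k) choose 2) + (3 * r + 2) * (r + 1 + (1 + k)))) UNIV"
    by (simp add: fpsum_reindex F_def sgn1_def case_prod_unfold neg)
  have "(\<Sum>n. \<Sum>m = - int (n div 2)..int (n div 2). of_int (sgn1 m) * fps_X ^ hecke_exp n m) =
          (\<Sum>n. fpsum (\<lambda>m. F (n, m)) {- int (n div 2)..int (n div 2)})"
    by (simp add: F_def fpsum_finite)
  also have "\<dots> = fpsum F H"
    using fpsum_Sigma[of "\<lambda>n m. F (n, m)" UNIV "\<lambda>n. {- int (n div 2)..int (n div 2)}"] F
    by (simp add: H_def suminf_eq_fpsum)
  \<comment> \<open>Grouped by \<open>s\<close> and not by sign: \<open>A\<close> and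
    \<open>C\<close> belong to s = 0, \<open>B\<close> and \<open>D\<close> to s = 1.\<close>
  also have "H = (A \<union> C) \<union> (B \<union> D)" by (auto simp: A_def B_def C_def D_def)
  also have "fpsum F ((A \<union> C) \<union> (B \<union> D)) = (fpsum F A + fpsum F C) + (fpsum F B + fpsum F D)"
  proof -
    have sub: "locfin F X" if "X \<subseteq> H" for X using F that by (rule locfin_subset)
    have "fpsum F ((A \<union> C) \<union> (B \<union> D)) = fpsum F (A \<union> C) + fpsum F (B \<union> D)"
      by (rule fpsum_Un_disjoint[OF sub]) (auto simp: A_def B_def C_def D_def)
    moreover have "fpsum F (A \<union> C) = fpsum F A + fpsum F C"
      by (rule fpsum_Un_disjoint[OF sub]) (auto simp: A_def C_def)
    moreover have "fpsum F (B \<union> D) = fpsum F B + fpsum F D"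
      by (rule fpsum_Un_disjoint[OF sub]) (auto simp: B_def D_def)
    ultimately show ?thesis by simp
  qed
  finally show ?thesis
    using fpsum_false_theta[of 0, where 'a = 'a] fpsum_false_theta[of 1, where 'a = 'a]
    unfolding A B C D by simp
qed

text \<open>Multiplication by (q;q)_inf turns every t_k into a false theta series. The two forms of
  the theorem differ only in how they express (q;q)_inf (-q;q)_inf^2.\<close>

lemma euler_sum_mock_theta_hecke:
  "qpoch_inf fps_X fps_X * ((euler_sum 1)\<^sup>2 * mock_theta_f) =
     (\<Sum>n. \<Sum>m = - int (n div 2)..int (n div 2). of_int (sgn1 m) * fps_X ^ hecke_exp n m :: 'a::field_char_0 fps)"
proof -
  have l: "locfin (\<lambda>k. fps_X ^ (Suc (s + k) choose 2) * F k) UNIV" for s and F :: "nat \<Rightarrow> 'a fps"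
    by (rule locfin_power_nat[of _ 0]) (simp add: choose_two_Suc)
  have "qpoch_inf fps_X fps_X * fpsum (\<lambda>k. fps_X ^ (Suc (s + k) choose 2) * hecke_coeff (s + k)) UNIV =
          fpsum (\<lambda>k. fps_X ^ (Suc (s + k) choose 2) * (false_theta (s + k) :: 'a fps)) UNIV" for s
    by (subst fpsum_cmult[OF l, symmetric]) (simp add: hecke_coeff_eq[symmetric] mult_ac)
  from this[of 0] this[of 1] show ?thesis
    unfolding euler_sum_mock_theta hecke_sum_eq by (simp add: distrib_left)
qed

theorem mainTheorem2:
  shows "(mock_theta_f :: 'a::field_char_0 fps) =
           qpoch_inf fps_X fps_X / (qpoch_inf (fps_X\<^sup>2) (fps_X\<^sup>2))\<^sup>2 *
           (\<Sum>n. \<Sum>m = - int (n div 2)..int (n div 2).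
              of_int (sgn1 m) * fps_X ^ hecke_exp n m) \<and>
         (\<Sum>n. fps_X ^ (n * (n + 1) div 2)) * (mock_theta_f :: 'a fps) =
           (\<Sum>n. \<Sum>m = - int (n div 2)..int (n div 2).
              of_int (sgn1 m) * fps_X ^ hecke_exp n m)"
proof -
  define Q E where "Q = (qpoch_inf fps_X fps_X :: 'a fps)" and "E = (euler_sum 1 :: 'a fps)"
  define H :: "'a fps" where
    "H = (\<Sum>n. \<Sum>m = - int (n div 2)..int (n div 2). of_int (sgn1 m) * fps_X ^ hecke_exp n m)"
  have H: "H = Q * (E\<^sup>2 * mock_theta_f)"
    unfolding H_def Q_def E_def by (rule euler_sum_mock_theta_hecke[symmetric])
  \<comment> \<open>\<open>durfee_sum_eq\<close> exhibits an inverse of \<open>Q\<close>, so its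
    constant term is not zero.\<close>
  have "fps_nth (durfee_sum 0 * Q) 0 = 1" by (simp add: Q_def durfee_sum_eq)
  hence "fps_nth Q 0 \<noteq> 0" by auto
  hence unit: "fps_nth ((Q * E)\<^sup>2) 0 \<noteq> 0"
    by (simp add: power2_eq_square E_def euler_sum_1_nth_0 del: One_nat_def)
  \<comment> \<open>By \<open>qpoch_inf_X2\<close>, \<open>Q * E\<close> is (q^2;q^2)_inf; its
    square is a unit, so division is multiplication by the inverse.\<close>
  have "Q / (Q * E)\<^sup>2 * H = mock_theta_f * ((Q * E)\<^sup>2 * inverse ((Q * E)\<^sup>2))"
    by (simp only: fps_divide_unit[OF unit] H) (simp add: power2_eq_square mult_ac)
  also have "\<dots> = mock_theta_f" by (simp only: inverse_mult_eq_1'[OF unit] mult_1_right)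
  finally have 1: "mock_theta_f = Q / (Q * E)\<^sup>2 * H" ..
  have "(\<Sum>n. fps_X ^ (n * (n + 1) div 2)) = fpsum (\<lambda>k. fps_X ^ (Suc k choose 2) :: 'a fps) UNIV"
    using suminf_eq_fpsum[OF locfin_triangular[of "\<lambda>_. 1 :: 'a fps"]]
    by (simp add: choose_two mult.commute)
  also have "\<dots> = E\<^sup>2 * Q" by (simp add: gauss_triangular E_def Q_def)
  finally have 2: "(\<Sum>n. fps_X ^ (n * (n + 1) div 2)) * mock_theta_f = H"
    by (simp add: H mult_ac)
  show ?thesis
    using 1 2 unfolding qpoch_inf_X2 Q_def E_def H_def by blast
qed

end
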